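(* For all $r,t\in\mathbb{N}$, every graph $G$ that does not contain the complete graph $K_t$ as a minor satisfies $\operatorname{cw}_r(G)\leq \binom{t-1}{2}(8r+1)$.
   Context: All graphs are finite, simple and undirected; $\mathbb{N}=\{1,2,\dots\}$. Cop-width game with radius $r$ and width $k$ on $G$: initially the cops occupy a set $C_0\subseteq V(G)$ with $|C_0|\le k$ and the robber chooses a vertex $x_0$. In each round $i\ge1$, the cops announce a new set $C_i\subseteq V(G)$ with $|C_i|\le k$; the robber, knowing $C_i$, moves from $x_{i-1}$ to a vertex $x_i$ along a path in $G$ of length at most $r$ containing no vertex of $C_{i-1}\cap C_i$. The robber is caught if $x_i\in C_i$. The radius-$r$ cop-width $\operatorname{cw}_r(G)$ is the least $k\in\mathbb{N}$ such that the cops can guarantee capture in finitely many rounds.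
   Formalization: The formal theorem assumes t ≥ 3: for t ≤ 2 the bound is 0 while the cop-width is at least 1 by definition, so the printed inequality fails (e.g. t = 2 and G a single vertex). *)

theory Defs
  imports "Graph_Theory.Graph_Theory"
begin

text \<open>
  Finite simple undirected graphs are rendered by the locale predicate \<^const>\<open>graph\<close>: finite
  symmetric loop-free digraphs without parallel arcs. An edge is a pair of opposite arcs.
\<close>

definition complete_graph :: "nat \<Rightarrow> (nat, nat \<times> nat) pre_digraph" where
  "complete_graph t = with_proj \<lparr>pverts = {..<t}, parcs = {(u, v). u < t \<and> v < t \<and> u \<noteq> v}\<rparr>"

lemma complete_digraph_complete_graph: "complete_digraph t (complete_graph t)"
  unfolding complete_graph_def by (subst complete_digraph_pair_def) auto

text \<open>
  The sets \<open>B u\<close> are the branch sets of a model of \<open>H\<close> in \<open>G\<close>. They are nonempty, because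
  \<^const>\<open>Digraph_Component.connected\<close> excludes the null graph.
\<close>

definition is_minor :: "('c, 'd) pre_digraph \<Rightarrow> ('a, 'b) pre_digraph \<Rightarrow> bool" where
  "is_minor H G \<longleftrightarrow> (\<exists>B :: 'c \<Rightarrow> 'a set.
     (\<forall>u \<in> verts H. B u \<subseteq> verts G \<and> Digraph_Component.connected (G \<restriction> B u)) \<and>
     (\<forall>u \<in> verts H. \<forall>v \<in> verts H. u \<noteq> v \<longrightarrow> B u \<inter> B v = {}) \<and>
     (\<forall>u v. u \<rightarrow>\<^bsub>H\<^esub> v \<longrightarrow> (\<exists>x \<in> B u. \<exists>y \<in> B v. x \<rightarrow>\<^bsub>G\<^esub> y)))"

definition robber_move ::
  "nat \<Rightarrow> ('a, 'b) pre_digraph \<Rightarrow> 'a set \<Rightarrow> 'a set \<Rightarrow> 'a \<Rightarrow> 'a \<Rightarrow> bool" where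
  "robber_move r G C C' x y \<longleftrightarrow>
     (\<exists>p. vpath p G \<and> hd p = x \<and> last p = y \<and> vwalk_length p \<le> r \<and> set p \<inter> (C \<inter> C') = {})"

text \<open>
  A cop strategy \<open>\<sigma>\<close> maps the robber's positions so far to the next cop set, so a play in which
  the robber visits \<open>x 0, x 1, \<dots>\<close> has the cop sets below.
\<close>

definition cops_at :: "('a list \<Rightarrow> 'a set) \<Rightarrow> (nat \<Rightarrow> 'a) \<Rightarrow> nat \<Rightarrow> 'a set" where
  "cops_at \<sigma> x i = \<sigma> (map x [0..<i])"

text \<open>
  It suffices to consider infinite plays: a robber who has not been caught can always
  stay where he is, so every finite play without capture extends to an infinite one.
\<close>

definition cops_win :: "nat \<Rightarrow> nat \<Rightarrow> ('a, 'b) pre_digraph \<Rightarrow> bool" where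
  "cops_win r k G \<longleftrightarrow> (\<exists>\<sigma> :: 'a list \<Rightarrow> 'a set.
     (\<forall>h. \<sigma> h \<subseteq> verts G \<and> card (\<sigma> h) \<le> k) \<and>
     (\<forall>x. x 0 \<in> verts G \<and>
          (\<forall>i. robber_move r G (cops_at \<sigma> x i) (cops_at \<sigma> x (Suc i)) (x i) (x (Suc i)))
        \<longrightarrow> (\<exists>i. x i \<in> cops_at \<sigma> x i)))"

definition cop_width :: "nat \<Rightarrow> ('a, 'b) pre_digraph \<Rightarrow> nat" where
  "cop_width r G = (LEAST k. 1 \<le> k \<and> cops_win r k G)"

text \<open>The minimum is attained, since occupying every vertex wins.\<close>

lemma cops_win_card: "card (verts G) \<le> k \<Longrightarrow> cops_win r k G"
  unfolding cops_win_def cops_at_def by (rule exI[of _ "\<lambda>_. verts G"]) auto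

lemma cop_width_attained: "1 \<le> cop_width r G \<and> cops_win r (cop_width r G) G"
  unfolding cop_width_def
  by (rule LeastI[of _ "Suc (card (verts G))"]) (simp add: cops_win_card)

end

theory Submission
  imports Defs
begin

text \<open>
  The cops maintain a clique model whose branch sets are guarded trees together with the connected
  territory \<open>R\<close> of the robber, all neighbours of \<open>R\<close> lying in the trees. In every round they add a
  tree inside \<open>R\<close>: geodesics of \<open>R\<close> from a common root to a neighbour of each old tree. The distance
  from the root is 1-Lipschitz along every later move of the robber, so a tree is guarded by occupying
  its vertices in the fewer than \<open>4r\<close> levels whose distance from the robber's level is less
  than \<open>2r\<close>. Thus \<open>R\<close> shrinks in every round, and trees that no longer touch it are
  abandoned. Without a \<open>K\<^sub>t\<close> minor there are at most \<open>t - 2\<close> old trees, so at most \<open>t - 1\<close> trees are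
  guarded at once, and each of them has at most \<open>t - 2\<close> vertices on every level. This uses at
  most \<open>(t - 1)(t - 2)4r\<close> cops.
\<close>

section \<open>Connectivity inside a vertex set\<close>

definition connected_set :: "('a \<times> 'a) set \<Rightarrow> 'a set \<Rightarrow> bool" where
  "connected_set E B \<longleftrightarrow> B \<noteq> {} \<and> (\<forall>u \<in> B. \<forall>v \<in> B. (u, v) \<in> rtrancl_on B E)"

definition adjacent_sets :: "('a \<times> 'a) set \<Rightarrow> 'a set \<Rightarrow> 'a set \<Rightarrow> bool" where
  "adjacent_sets E A B \<longleftrightarrow> (\<exists>u \<in> A. \<exists>v \<in> B. (u, v) \<in> E)"

lemma adjacent_sets_sym: "sym E \<Longrightarrow> adjacent_sets E A B \<Longrightarrow> adjacent_sets E B A"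
  unfolding adjacent_sets_def by (blast dest: symD)

lemma rtrancl_on_subset_mono:
  assumes "(u, v) \<in> rtrancl_on A E" and "A \<subseteq> B"
  shows "(u, v) \<in> rtrancl_on B E"
  using assms by (induct rule: rtrancl_on_induct) (auto intro: rtrancl_on_into_rtrancl_on)

lemma connected_setI_root:
  assumes "sym E" and "v \<in> B" and "\<And>u. u \<in> B \<Longrightarrow> (v, u) \<in> rtrancl_on B E"
  shows "connected_set E B"
  unfolding connected_set_def
  using assms by (meson empty_iff rtrancl_on_sym rtrancl_on_trans symD)

lemma connected_set_UN:
  assumes "sym E" and "A \<noteq> {}" and "\<And>a. a \<in> A \<Longrightarrow> v \<in> P a \<and> connected_set E (P a)"
  shows "connected_set E (\<Union>a\<in>A. P a)"
proof (rule connected_setI_root[OF assms(1)])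
  show "v \<in> (\<Union>a\<in>A. P a)" using assms by blast
  fix u assume "u \<in> (\<Union>a\<in>A. P a)"
  then obtain a where a: "a \<in> A" "u \<in> P a" by blast
  then have "(v, u) \<in> rtrancl_on (P a) E"
    using assms(3) unfolding connected_set_def by blast
  then show "(v, u) \<in> rtrancl_on (\<Union>a\<in>A. P a) E"
    by (rule rtrancl_on_subset_mono) (use a in blast)
qed

text \<open>A path from \<open>x\<close> inside \<open>A\<close> visits only vertices that are
  themselves reachable from \<open>x\<close> inside \<open>A\<close>, so it never leaves the
  component.\<close>

lemma connected_set_component:
  assumes "sym E" and "x \<in> A"
  shows "connected_set E {y. (x, y) \<in> rtrancl_on A E}"
proof (rule connected_setI_root[OF assms(1)])
  show "x \<in> {y. (x, y) \<in> rtrancl_on A E}" using assms by simp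
  fix u assume "u \<in> {y. (x, y) \<in> rtrancl_on A E}"
  then have "(x, u) \<in> rtrancl_on A E" by simp
  then show "(x, u) \<in> rtrancl_on {y. (x, y) \<in> rtrancl_on A E} E"
  proof (induct rule: rtrancl_on_induct)
    case base
    then show ?case by simp
  next
    case (step y z)
    then show ?case by (auto intro: rtrancl_on_into_rtrancl_on)
  qed
qed

subsection \<open>Breadth-first layerings\<close>

text \<open>The invariant uses this with the territory \<open>R\<close> as first set and
  \<open>R \<union> T\<close> as second: \<open>f\<close> is then controlled along steps inside
  \<open>R\<close> and along a step from \<open>R\<close> into the tree \<open>T\<close>, while
  edges joining two vertices of \<open>T\<close> outside \<open>R\<close> stay
  unconstrained.\<close>

definition lipschitz_on_edges :: "('a \<times> 'a) set \<Rightarrow> 'a set \<Rightarrow> 'a set \<Rightarrow> ('a \<Rightarrow> nat) \<Rightarrow> bool" where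
  "lipschitz_on_edges E R T f \<longleftrightarrow>
     (\<forall>u \<in> R. \<forall>w \<in> T. (u, w) \<in> E \<longrightarrow> f w \<le> f u + 1 \<and> f u \<le> f w + 1)"

lemma lipschitz_on_edges_subset:
  "lipschitz_on_edges E R T f \<Longrightarrow> R' \<subseteq> R \<Longrightarrow> T' \<subseteq> T \<Longrightarrow> lipschitz_on_edges E R' T' f"
  unfolding lipschitz_on_edges_def by blast

text \<open>The function is the distance from \<open>v\<close> inside \<open>R\<close>, and
  \<open>P\<close> is the vertex set of a geodesic. Injectivity of \<open>f\<close> on
  \<open>P\<close> keeps the one feature of geodesics that matters for counting cops: each level is
  met at most once.\<close>

lemma bfs_layering:
  assumes "sym E" and "connected_set E R" and "v \<in> R"
  obtains f where "lipschitz_on_edges E R R f"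
    and "\<And>a. a \<in> R \<Longrightarrow> \<exists>P. v \<in> P \<and> a \<in> P \<and> P \<subseteq> R \<and> connected_set E P \<and> inj_on f P"
proof -
  define D where "D = E \<inter> R \<times> R"
  define f where "f y = (LEAST n. (v, y) \<in> D ^^ n)" for y
  have reach: "(v, y) \<in> D ^^ f y" if "y \<in> R" for y
  proof -
    have "(v, y) \<in> rtrancl_on R E"
      using assms(2,3) that unfolding connected_set_def by blast
    then have "(v, y) \<in> D\<^sup>*"
      by (induct rule: rtrancl_on_induct) (auto simp: D_def intro: rtrancl_into_rtrancl)
    then obtain n where "(v, y) \<in> D ^^ n" using rtrancl_imp_relpow by metis
    then show ?thesis unfolding f_def by (rule LeastI)
  qed
  have f_le: "f y \<le> n" if "(v, y) \<in> D ^^ n" for y n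
    unfolding f_def by (rule Least_le) (rule that)
  have step: "f w \<le> f u + 1" if "u \<in> R" "w \<in> R" "(u, w) \<in> E" for u w
  proof -
    have "(v, w) \<in> D ^^ Suc (f u)"
      using reach[OF that(1)] that by (auto simp: D_def)
    from f_le[OF this] show ?thesis by simp
  qed
  have lip: "lipschitz_on_edges E R R f"
    unfolding lipschitz_on_edges_def using step assms(1) by (blast dest: symD)
  \<comment> \<open>The bound on the levels of \<open>P\<close> strengthens the induction: the new
    endpoint has level \<open>Suc n\<close>, above everything in \<open>P\<close>, so injectivity
    survives its insertion.\<close>
  have path: "\<exists>P. v \<in> P \<and> a \<in> P \<and> P \<subseteq> R \<and> connected_set E P \<and> inj_on f P \<and> (\<forall>y \<in> P. f y \<le> n)"
    if "a \<in> R" "f a = n" for a n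
    using that
  proof (induction n arbitrary: a)
    case 0
    then have "a = v" using reach[of a] by simp
    then show ?case using assms(3) 0
      by (intro exI[of _ "{v}"]) (auto simp: connected_set_def)
  next
    case (Suc n)
    then obtain u where u: "(v, u) \<in> D ^^ n" "(u, a) \<in> D"
      using reach[of a] by auto
    then have uR: "u \<in> R" "(u, a) \<in> E" by (auto simp: D_def)
    have "f u = n" using f_le[OF u(1)] step[OF uR(1) Suc.prems(1) uR(2)] Suc.prems(2) by simp
    from Suc.IH[OF uR(1) this] obtain P where P: "v \<in> P" "u \<in> P" "P \<subseteq> R" "connected_set E P"
      "inj_on f P" "\<forall>y \<in> P. f y \<le> n" by blast
    have "connected_set E (insert a P)"
    proof (rule connected_setI_root[OF assms(1)])
      show "v \<in> insert a P" using P by simp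
      have *: "(v, y) \<in> rtrancl_on (insert a P) E" if "y \<in> P" for y
        by (rule rtrancl_on_subset_mono[of _ _ P]) (use P that in \<open>auto simp: connected_set_def\<close>)
      fix y assume "y \<in> insert a P"
      then show "(v, y) \<in> rtrancl_on (insert a P) E"
        using * rtrancl_on_into_rtrancl_on[OF *[OF P(2)] uR(2)] by blast
    qed
    moreover have "inj_on f (insert a P)"
      using P(5,6) Suc.prems(2) by fastforce
    ultimately show ?case using P Suc.prems
      by (intro exI[of _ "insert a P"]) (auto simp: le_Suc_eq)
  qed
  show thesis
  proof (rule that[OF lip])
    fix a assume "a \<in> R"
    from path[OF this refl] show "\<exists>P. v \<in> P \<and> a \<in> P \<and> P \<subseteq> R \<and> connected_set E P \<and> inj_on f P"
      by blast
  qed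
qed

section \<open>Layered trees and the windows that guard them\<close>

definition levels_le :: "nat \<Rightarrow> 'a set \<Rightarrow> ('a \<Rightarrow> nat) \<Rightarrow> bool" where
  "levels_le m T f \<longleftrightarrow> (\<forall>l. card {y \<in> T. f y = l} \<le> m)"

text \<open>\<open>T\<close> is the union of one geodesic from a common root to each point of
  \<open>A\<close>. Each geodesic contributes at most one vertex to a level. Acyclicity is not
  claimed.\<close>

lemma bfs_tree:
  assumes "sym E" and "connected_set E R" and "A \<subseteq> R" and "A \<noteq> {}" and "finite R"
  obtains T f where "A \<subseteq> T" and "T \<subseteq> R" and "connected_set E T"
    and "lipschitz_on_edges E R R f" and "levels_le (card A) T f"
proof -
  obtain v where v: "v \<in> R" using assms by blast
  from bfs_layering[OF assms(1,2) v] obtain f where f: "lipschitz_on_edges E R R f"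
    "\<forall>a \<in> R. \<exists>P. v \<in> P \<and> a \<in> P \<and> P \<subseteq> R \<and> connected_set E P \<and> inj_on f P" by metis
  then obtain P where P: "\<forall>a \<in> R. v \<in> P a \<and> a \<in> P a \<and> P a \<subseteq> R \<and> connected_set E (P a) \<and> inj_on f (P a)"
    by metis
  have finA: "finite A" using assms finite_subset by blast
  let ?T = "\<Union>a\<in>A. P a"
  have "levels_le (card A) ?T f"
    unfolding levels_le_def
  proof
    fix l
    have "{y \<in> ?T. f y = l} = (\<Union>a\<in>A. {y \<in> P a. f y = l})" by blast
    also have "card \<dots> \<le> (\<Sum>a\<in>A. card {y \<in> P a. f y = l})"
      by (rule card_UN_le[OF finA])
    also have "\<dots> \<le> (\<Sum>a\<in>A. 1)"
    proof (rule sum_mono)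
      fix a assume "a \<in> A"
      then have "a \<in> R" using assms(3) by blast
      then have Pa: "inj_on f (P a)" "finite {y \<in> P a. f y = l}"
        using P assms(5) by (auto intro: finite_subset)
      have "y = z" if "y \<in> {y \<in> P a. f y = l}" "z \<in> {y \<in> P a. f y = l}" for y z
        using that Pa(1) by (auto dest: inj_onD)
      then show "card {y \<in> P a. f y = l} \<le> 1"
        by (simp add: card_le_Suc0_iff_eq[OF Pa(2)])
    qed
    finally show "card {y \<in> ?T. f y = l} \<le> card A" by simp
  qed
  moreover have "connected_set E ?T"
    by (rule connected_set_UN[OF assms(1), of A v P]) (use P assms in blast)+
  ultimately show thesis
    using that[of ?T f] P f(1) assms(3) by blast
qed

text \<open>This is the condition |f y - f x| < d, stated without truncated subtraction. The vertex
  \<open>x\<close> itself usually lies outside \<open>T\<close>.\<close>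

definition window :: "nat \<Rightarrow> 'a set \<Rightarrow> ('a \<Rightarrow> nat) \<Rightarrow> 'a \<Rightarrow> 'a set" where
  "window d T f x = {y \<in> T. f y < f x + d \<and> f x < f y + d}"

lemma card_window_le:
  assumes "finite T" and "levels_le m T f"
  shows "card (window d T f x) \<le> 2 * d * m"
proof -
  \<comment> \<open>The lower end is cut off at level 0 when \<open>f x\<close> is small; in every
    case at most \<open>2 * d\<close> levels remain.\<close>
  let ?L = "{f x + 1 - d ..< f x + d}"
  have "window d T f x \<subseteq> (\<Union>l\<in>?L. {y \<in> T. f y = l})"
    unfolding window_def by auto
  then have "card (window d T f x) \<le> card (\<Union>l\<in>?L. {y \<in> T. f y = l})"
    using assms(1) by (intro card_mono) auto
  also have "\<dots> \<le> (\<Sum>l\<in>?L. card {y \<in> T. f y = l})"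
    by (rule card_UN_le) simp
  also have "\<dots> \<le> (\<Sum>l\<in>?L. m)"
    using assms(2) unfolding levels_le_def by (intro sum_mono) blast
  also have "\<dots> = card ?L * m" by simp
  also have "\<dots> \<le> 2 * d * m"
    by (rule mult_right_mono) auto
  finally show ?thesis .
qed

subsection \<open>Clique minors from touching families\<close>

text \<open>An unindexed family makes abandoning a tree a mere passage to a subfamily. Its members
  are nonempty and disjoint, so its cardinality is the order of the clique minor.\<close>

definition clique_model :: "('a, 'b) pre_digraph \<Rightarrow> 'a set set \<Rightarrow> bool" where
  "clique_model G \<F> \<longleftrightarrow>
     (\<forall>A \<in> \<F>. A \<subseteq> verts G \<and> connected_set (arcs_ends G) A) \<and>
     (\<forall>A \<in> \<F>. \<forall>B \<in> \<F>. A \<noteq> B \<longrightarrow> A \<inter> B = {} \<and> adjacent_sets (arcs_ends G) A B)"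

lemma connected_induce_subgraph:
  assumes "connected_set (arcs_ends G) B"
  shows "Digraph_Component.connected (G \<restriction> B)"
proof -
  have "(u, v) \<in> rtrancl_on B ((arcs_ends (G \<restriction> B))\<^sup>s)" if "(u, v) \<in> rtrancl_on B (arcs_ends G)" for u v
    using that
  proof (induct rule: rtrancl_on_induct)
    case base
    then show ?case by simp
  next
    case (step y z)
    then have "(y, z) \<in> arcs_ends (G \<restriction> B)"
      by (auto simp: arcs_ends_def arc_to_ends_def)
    then show ?case using step by (auto simp: symcl_def intro: rtrancl_on_into_rtrancl_on)
  qed
  then show ?thesis using assms unfolding connected_conv connected_set_def by simp
qed

lemma is_minor_complete_graphI:
  assumes "clique_model G \<F>" and "finite \<F>" and "t \<le> card \<F>"
  shows "is_minor (complete_graph t) G"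
proof -
  obtain B where B: "inj_on B {..<t}" "B ` {..<t} \<subseteq> \<F>"
    using card_le_inj[of "{..<t}" \<F>] assms by auto
  have E: "u < t \<and> v < t \<and> u \<noteq> v" if "u \<rightarrow>\<^bsub>complete_graph t\<^esub> v" for u v
    using that by (auto simp: complete_graph_def arcs_ends_def arc_to_ends_def)
  have V: "verts (complete_graph t) = {..<t}" by (simp add: complete_graph_def)
  have ne: "B u \<noteq> B v" if "u < t" "v < t" "u \<noteq> v" for u v
    using B(1) that by (auto dest: inj_onD)
  have mem: "B u \<in> \<F>" if "u < t" for u using B(2) that by auto
  have sub: "B u \<subseteq> verts G \<and> Digraph_Component.connected (G \<restriction> B u)" if "u < t" for u
    using mem[OF that] assms(1) unfolding clique_model_def by (auto intro: connected_induce_subgraph)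
  have touch: "B u \<inter> B v = {} \<and> (\<exists>x \<in> B u. \<exists>y \<in> B v. x \<rightarrow>\<^bsub>G\<^esub> y)" if "u < t" "v < t" "u \<noteq> v" for u v
    using mem[OF that(1)] mem[OF that(2)] ne[OF that] assms(1)
    unfolding clique_model_def adjacent_sets_def by blast
  show ?thesis
    unfolding is_minor_def V
  proof (intro exI[of _ B] conjI ballI allI impI)
    show "\<exists>x \<in> B u. \<exists>y \<in> B v. x \<rightarrow>\<^bsub>G\<^esub> y" if "u \<rightarrow>\<^bsub>complete_graph t\<^esub> v" for u v
      using touch E[OF that] by simp
  qed (use sub touch in auto)
qed

subsection \<open>The invariant of the cop strategy\<close>

text \<open>A function \<open>f\<close> may have been built as a distance in an earlier, larger
  territory; only its Lipschitz property relative to the present \<open>R\<close> is retained.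
  Radius \<open>r\<close> suffices for \<open>C\<close>, since it covers all vertices of
  \<open>T\<close> that can be reached in fewer than \<open>r\<close> steps.\<close>

definition confined ::
  "('a, 'b) pre_digraph \<Rightarrow> nat \<Rightarrow> nat \<Rightarrow> 'a set \<Rightarrow> 'a \<Rightarrow> 'a set \<Rightarrow> bool" where
  "confined G r m R x C \<longleftrightarrow> x \<in> R \<and> (\<exists>\<T>. R \<notin> \<T> \<and> clique_model G (insert R \<T>) \<and>
     arcs_ends G `` R \<subseteq> R \<union> \<Union>\<T> \<and>
     (\<forall>T \<in> \<T>. \<exists>f. lipschitz_on_edges (arcs_ends G) R (R \<union> T) f \<and> levels_le m T f \<and>
        window r T f x \<subseteq> C))"

lemma vpath_sequence:
  assumes "vpath p G" and "hd p = x" and "last p = y"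
  obtains q n where "q 0 = x" and "q n = y" and "n = vwalk_length p"
    and "\<And>j. j < n \<Longrightarrow> (q j, q (Suc j)) \<in> arcs_ends G" and "\<And>j. j \<le> n \<Longrightarrow> q j \<in> set p"
proof (rule that[of "(!) p" "length p - 1"])
  have arcs: "set (vwalk_arcs p) \<subseteq> arcs_ends G" and ne: "p \<noteq> []"
    using assms(1) by (auto simp: vpath_def vwalk_def)
  show "p ! 0 = x" "p ! (length p - 1) = y"
    using assms(2,3) ne by (auto simp: hd_conv_nth last_conv_nth)
  show "length p - 1 = vwalk_length p" by simp
  have nth: "Suc j < length p \<Longrightarrow> (p ! j, p ! Suc j) \<in> set (vwalk_arcs p)" for j
    by (induct p arbitrary: j rule: vwalk_arcs.induct) (auto simp: nth_Cons split: nat.splits)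
  show "(p ! j, p ! Suc j) \<in> arcs_ends G" if "j < length p - 1" for j
    using nth[of j] arcs that by auto
  show "p ! j \<in> set p" if "j \<le> length p - 1" for j
    using ne that by (intro nth_mem) (cases p, auto)
qed

text \<open>
  A vertex of \<open>T\<close> that the robber reaches before the end of his move is blocked, since it lies in
  both cop sets; if he reaches it only with his last step, the new cop set already catches him.
\<close>

lemma robber_stays_or_caught:
  assumes "robber_move r G C C' x x'" and "x \<in> R" and nc: "x' \<notin> C'"
    and nbr: "arcs_ends G `` R \<subseteq> R \<union> \<Union>\<T>"
    and lip: "\<And>T. T \<in> \<T> \<Longrightarrow> lipschitz_on_edges (arcs_ends G) R (R \<union> T) (F T)"
    and old: "\<And>T. T \<in> \<T> \<Longrightarrow> window r T (F T) x \<subseteq> C"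
    and new: "\<And>T. T \<in> \<T> \<Longrightarrow> window (2 * r) T (F T) x \<subseteq> C'"
  shows "x' \<in> R"
    and "\<And>f. lipschitz_on_edges (arcs_ends G) R R f \<Longrightarrow> f x' \<le> f x + r \<and> f x \<le> f x' + r"
proof -
  obtain p where p: "vpath p G" "hd p = x" "last p = x'" "vwalk_length p \<le> r"
    "set p \<inter> (C \<inter> C') = {}"
    using assms(1) unfolding robber_move_def by blast
  obtain q n where q: "q 0 = x" "q n = x'" "n = vwalk_length p"
    "\<And>j. j < n \<Longrightarrow> (q j, q (Suc j)) \<in> arcs_ends G" "\<And>j. j \<le> n \<Longrightarrow> q j \<in> set p"
    using vpath_sequence[OF p(1-3)] by metis
  have n: "n \<le> r" using q(3) p(4) by simp
  \<comment> \<open>All Lipschitz functions are treated at once: those of the old trees show that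
    the next step stays in \<open>R\<close>, and the layering of the new tree is needed by the
    caller.\<close>
  have inv: "q j \<in> R \<and> (\<forall>f. lipschitz_on_edges (arcs_ends G) R R f \<longrightarrow>
           f (q j) \<le> f x + j \<and> f x \<le> f (q j) + j)" if "j \<le> n" for j
    using that
  proof (induction j)
    case 0
    then show ?case using q(1) assms(2) by simp
  next
    case (Suc j)
    then have IH: "q j \<in> R" "\<And>f. lipschitz_on_edges (arcs_ends G) R R f \<Longrightarrow>
         f (q j) \<le> f x + j \<and> f x \<le> f (q j) + j" by auto
    have e: "(q j, q (Suc j)) \<in> arcs_ends G" using q(4) Suc.prems by simp
    have inR: "q (Suc j) \<in> R"
    proof (rule ccontr)
      assume "q (Suc j) \<notin> R"
      then obtain T where T: "T \<in> \<T>" "q (Suc j) \<in> T" using nbr e IH(1) by blast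
      have "F T (q j) \<le> F T x + j \<and> F T x \<le> F T (q j) + j"
        by (rule IH(2)) (rule lipschitz_on_edges_subset[OF lip[OF T(1)]]; blast)
      moreover have "F T (q (Suc j)) \<le> F T (q j) + 1 \<and> F T (q j) \<le> F T (q (Suc j)) + 1"
        using lip[OF T(1)] e T(2) IH(1) unfolding lipschitz_on_edges_def by blast
      ultimately have d: "F T (q (Suc j)) \<le> F T x + Suc j" "F T x \<le> F T (q (Suc j)) + Suc j"
        by auto
      \<comment> \<open>A step has been made, so \<open>r\<close> is positive and a level difference
        of at most \<open>r\<close> is less than \<open>2 * r\<close>.\<close>
      then have "q (Suc j) \<in> window (2 * r) T (F T) x"
        using T(2) Suc.prems n by (simp add: window_def)
      then have C': "q (Suc j) \<in> C'" using new[OF T(1)] by blast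
      show False
      proof (cases "Suc j = n")
        case True
        then show False using C' q(2) nc by simp
      next
        case False
        \<comment> \<open>Now \<open>Suc j < n \<le> r\<close>, which gives the strict inequality
          demanded by the window of radius \<open>r\<close>.\<close>
        then have "q (Suc j) \<in> window r T (F T) x"
          using d T(2) Suc.prems n by (simp add: window_def)
        then show False using old[OF T(1)] C' p(5) q(5)[OF Suc.prems] by blast
      qed
    qed
    have "f (q (Suc j)) \<le> f x + Suc j \<and> f x \<le> f (q (Suc j)) + Suc j"
      if "lipschitz_on_edges (arcs_ends G) R R f" for f
    proof -
      have "f (q (Suc j)) \<le> f (q j) + 1 \<and> f (q j) \<le> f (q (Suc j)) + 1"
        using that e inR IH(1) unfolding lipschitz_on_edges_def by blast
      then show ?thesis using IH(2)[OF that] by auto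
    qed
    with inR show ?case by blast
  qed
  show "x' \<in> R" using inv[of n] q(2) by simp
  show "f x' \<le> f x + r \<and> f x \<le> f x' + r" if "lipschitz_on_edges (arcs_ends G) R R f" for f
  proof -
    have "f x' \<le> f x + n \<and> f x \<le> f x' + n" using inv[of n] q(2) that by simp
    then show ?thesis using n by auto
  qed
qed

text \<open>The territory is a branch set too, so it and the trees together number at most
  \<open>t - 1\<close>.\<close>

lemma card_le_of_no_clique_minor:
  assumes "\<not> is_minor (complete_graph t) G" and "clique_model G (insert R \<T>)"
    and "R \<notin> \<T>" and "finite \<T>"
  shows "card \<T> \<le> t - 2"
proof -
  have "card (insert R \<T>) < t"
    using is_minor_complete_graphI[OF assms(2), of t] assms(1,4) by (auto simp: not_less[symmetric])
  then show ?thesis using assms(3,4) by simp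
qed

section \<open>One round of the cop strategy\<close>

lemma confined_step:
  assumes "graph G" and "1 \<le> r" and "3 \<le> t"
    and "\<not> is_minor (complete_graph t) G"
    and "confined G r (t - 2) R x C"
  obtains C' where "C' \<subseteq> verts G" and "card C' \<le> (t - 1) * (t - 2) * (4 * r)"
    and "\<And>x'. robber_move r G C C' x x' \<Longrightarrow>
           x' \<in> C' \<or> (\<exists>R'. R' \<subset> R \<and> confined G r (t - 2) R' x' C')"
proof -
  interpret graph G by fact
  let ?E = "arcs_ends G"
  have symE: "sym ?E" using sym_arcs by (simp add: symmetric_def)
  from assms(5) obtain \<T> where x: "x \<in> R" and RT: "R \<notin> \<T>"
    and model: "clique_model G (insert R \<T>)" and nbr: "?E `` R \<subseteq> R \<union> \<Union>\<T>"
    and guard: "\<forall>T \<in> \<T>. \<exists>f. lipschitz_on_edges ?E R (R \<union> T) f \<and> levels_le (t - 2) T f \<and>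
        window r T f x \<subseteq> C"
    unfolding confined_def by blast
  from guard obtain F0 where F0: "\<forall>T \<in> \<T>. lipschitz_on_edges ?E R (R \<union> T) (F0 T) \<and>
      levels_le (t - 2) T (F0 T) \<and> window r T (F0 T) x \<subseteq> C" by metis
  have RV: "R \<subseteq> verts G" "connected_set ?E R"
    and TV: "\<forall>T \<in> \<T>. T \<subseteq> verts G \<and> connected_set ?E T"
    using model by (simp_all add: clique_model_def)
  have "T \<inter> R = {} \<and> adjacent_sets ?E R T" if "T \<in> \<T>" for T
  proof -
    have "R \<noteq> T" using that RT by blast
    then show ?thesis using that model by (auto simp: clique_model_def)
  qed
  then have disj: "\<forall>T \<in> \<T>. T \<inter> R = {}" and adj: "\<forall>T \<in> \<T>. adjacent_sets ?E R T"
    by simp_all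
  have finT: "finite \<T>"
    by (rule finite_subset[of _ "Pow (verts G)"]) (use TV in auto)
  have finR: "finite R" using RV(1) finite_verts finite_subset by blast
  have cardT: "card \<T> \<le> t - 2"
    by (rule card_le_of_no_clique_minor[OF assms(4) model RT finT])

  \<comment> \<open>The geodesics will end at these contact vertices, which makes the new tree
    adjacent to every old one.\<close>
  from adj obtain a where a: "\<forall>T \<in> \<T>. a T \<in> R \<and> (\<exists>y \<in> T. (a T, y) \<in> ?E)"
    unfolding adjacent_sets_def by metis
  \<comment> \<open>Without old trees a single vertex serves as the new tree's target; its
    cardinality 1 is within \<open>t - 2\<close> because \<open>3 \<le> t\<close>.\<close>
  define A where "A = (if \<T> = {} then {x} else a ` \<T>)"
  have A: "A \<subseteq> R" "A \<noteq> {}" "a ` \<T> \<subseteq> A" using x a by (auto simp: A_def)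
  have cardA: "card A \<le> t - 2"
    using assms(3) cardT card_image_le[OF finT, of a] by (auto simp: A_def)
  obtain T0 f0 where T0: "A \<subseteq> T0" "T0 \<subseteq> R" "connected_set ?E T0"
    and f0: "lipschitz_on_edges ?E R R f0" "levels_le (card A) T0 f0"
    using bfs_tree[OF symE RV(2) A(1,2) finR] by metis
  have T0_ne: "T0 \<noteq> {}" using T0 A by blast
  have T0_new: "T0 \<notin> \<T>" using disj T0(2) T0_ne by blast
  have T0_adj: "adjacent_sets ?E T0 T" if "T \<in> \<T>" for T
    using a that A(3) T0(1) unfolding adjacent_sets_def by blast
  define \<U> where "\<U> = insert T0 \<T>"
  define F where "F T = (if T = T0 then f0 else F0 T)" for T
  have F_old: "F T = F0 T" if "T \<in> \<T>" for T using that T0_new by (auto simp: F_def)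
  have F_lip: "lipschitz_on_edges ?E R (R \<union> T) (F T)" if "T \<in> \<U>" for T
    using that f0(1) T0(2) F0 F_old by (auto simp: \<U>_def F_def Un_absorb2)
  have F_lev: "levels_le (t - 2) T (F T)" if "T \<in> \<U>" for T
    using that f0(2) F0 F_old cardA
    by (auto simp: \<U>_def F_def levels_le_def intro: order_trans)
  have UV: "T \<subseteq> verts G" if "T \<in> \<U>" for T using that TV T0(2) RV(1) by (auto simp: \<U>_def)
  \<comment> \<open>The set is announced before the robber moves, hence is centred at
    \<open>x\<close>. His level changes by at most \<open>r\<close>, so radius \<open>2 * r\<close>
    around \<open>x\<close> contains the window of radius \<open>r\<close> around his next
    position.\<close>
  define C' where "C' = (\<Union>T\<in>\<U>. window (2 * r) T (F T) x)"
  have C'_V: "C' \<subseteq> verts G" using UV by (auto simp: C'_def window_def)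

  have "card C' \<le> (\<Sum>T\<in>\<U>. card (window (2 * r) T (F T) x))"
    unfolding C'_def by (rule card_UN_le) (simp add: \<U>_def finT)
  also have "\<dots> \<le> (\<Sum>T\<in>\<U>. 2 * (2 * r) * (t - 2))"
    by (intro sum_mono card_window_le F_lev finite_subset[OF UV finite_verts])
  also have "\<dots> = card \<U> * ((t - 2) * (4 * r))" by simp
  also have "\<dots> \<le> (t - 1) * ((t - 2) * (4 * r))"
    using cardT T0_new finT assms(3) by (intro mult_right_mono) (auto simp: \<U>_def)
  finally have C'_card: "card C' \<le> (t - 1) * (t - 2) * (4 * r)" by (simp add: mult.assoc)

  have "\<exists>R'. R' \<subset> R \<and> confined G r (t - 2) R' x' C'"
    if move: "robber_move r G C C' x x'" and nc: "x' \<notin> C'" for x'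
  proof -
    have lip': "\<And>T. T \<in> \<T> \<Longrightarrow> lipschitz_on_edges ?E R (R \<union> T) (F T)"
      using F_lip by (simp add: \<U>_def)
    have old': "\<And>T. T \<in> \<T> \<Longrightarrow> window r T (F T) x \<subseteq> C" using F0 F_old by simp
    have new': "\<And>T. T \<in> \<T> \<Longrightarrow> window (2 * r) T (F T) x \<subseteq> C'" by (auto simp: C'_def \<U>_def)
    have x'R: "x' \<in> R" by (rule robber_stays_or_caught(1)[OF move x nc nbr lip' old' new'])
    have near: "F T x' \<le> F T x + r \<and> F T x \<le> F T x' + r" if "T \<in> \<U>" for T
    proof -
      have "lipschitz_on_edges ?E R R (F T)"
        by (rule lipschitz_on_edges_subset[OF F_lip[OF that]]) auto
      then show ?thesis by (rule robber_stays_or_caught(2)[OF move x nc nbr lip' old' new', rotated -1])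
    qed
    \<comment> \<open>The new tree need not be guarded by \<open>C\<close>, so the robber may cross
      it during this move; he is caught if he ends on it, his level then being within
      \<open>r\<close> of that of \<open>x\<close>.\<close>
    have x'T0: "x' \<notin> T0"
    proof
      assume "x' \<in> T0"
      then have "x' \<in> window (2 * r) T0 (F T0) x"
        using near[of T0] assms(2) by (auto simp: window_def \<U>_def)
      then show False using nc by (auto simp: C'_def \<U>_def)
    qed
    define R' where "R' = {y. (x', y) \<in> rtrancl_on (R - T0) ?E}"
    have R'_sub: "R' \<subseteq> R - T0" unfolding R'_def by (auto dest: in_rtrancl_on_in_F)
    have R'_conn: "connected_set ?E R'"
      unfolding R'_def by (rule connected_set_component[OF symE]) (use x'R x'T0 in simp)
    have x'R': "x' \<in> R'" using x'R x'T0 by (simp add: R'_def)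
    \<comment> \<open>Keeping only the trees that touch \<open>R'\<close> preserves the clique
      model, and it loses no neighbour of \<open>R'\<close>.\<close>
    define \<T>' where "\<T>' = {T \<in> \<U>. adjacent_sets ?E R' T}"
    have disj': "T \<inter> R' = {}" if "T \<in> \<U>" for T
      using that disj R'_sub by (auto simp: \<U>_def)
    have "R' \<notin> \<T>'" using disj' x'R' by (auto simp: \<T>'_def)
    moreover have "clique_model G (insert R' \<T>')"
    proof -
      have pair: "S \<inter> T = {} \<and> adjacent_sets ?E S T" if "S \<in> \<U>" "T \<in> \<U>" "S \<noteq> T" for S T
      proof -
        have 1: "S \<inter> T = {} \<and> adjacent_sets ?E S T" if "S \<in> \<T>" "T \<in> \<T>" "S \<noteq> T"
          using model that unfolding clique_model_def by blast
        have 2: "T0 \<inter> T = {} \<and> adjacent_sets ?E T0 T" if "T \<in> \<T>" for T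
          using disj T0(2) T0_adj that by blast
        show ?thesis
          using that 1 2 adjacent_sets_sym[OF symE] unfolding \<U>_def by blast
      qed
      have "T \<subseteq> verts G \<and> connected_set ?E T" if "T \<in> \<U>" for T
        using that TV UV T0(3) by (auto simp: \<U>_def)
      moreover have "R' \<subseteq> verts G" using R'_sub RV(1) by blast
      ultimately show ?thesis
        using pair disj' R'_conn adjacent_sets_sym[OF symE]
        unfolding clique_model_def \<T>'_def by (simp add: Int_commute)
    qed
    moreover have "?E `` R' \<subseteq> R' \<union> \<Union>\<T>'"
    proof
      fix y assume "y \<in> ?E `` R'"
      then obtain u where u: "u \<in> R'" "(u, y) \<in> ?E" by blast
      show "y \<in> R' \<union> \<Union>\<T>'"
      proof (cases "y \<in> R - T0")
        case True
        then have "y \<in> R'"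
          using u unfolding R'_def by (auto intro: rtrancl_on_into_rtrancl_on)
        then show ?thesis by blast
      next
        case False
        have "y \<in> R \<union> \<Union>\<T>" using nbr u R'_sub by blast
        with False obtain T where "T \<in> \<U>" "y \<in> T" by (auto simp: \<U>_def)
        then show ?thesis using u by (auto simp: \<T>'_def adjacent_sets_def)
      qed
    qed
    moreover have "lipschitz_on_edges ?E R' (R' \<union> T) (F T) \<and> levels_le (t - 2) T (F T) \<and>
        window r T (F T) x' \<subseteq> C'" if "T \<in> \<T>'" for T
    proof -
      have T: "T \<in> \<U>" using that by (simp add: \<T>'_def)
      have "window r T (F T) x' \<subseteq> window (2 * r) T (F T) x"
        using near[OF T] by (auto simp: window_def)
      moreover have "lipschitz_on_edges ?E R' (R' \<union> T) (F T)"
        by (rule lipschitz_on_edges_subset[OF F_lip[OF T]]) (use R'_sub in blast)+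
      ultimately show ?thesis using T F_lev by (auto simp: C'_def)
    qed
    ultimately have "confined G r (t - 2) R' x' C'"
      unfolding confined_def using x'R' by blast
    moreover have "R' \<subset> R" using R'_sub T0(2) T0_ne by blast
    ultimately show ?thesis by blast
  qed
  then show thesis using that[OF C'_V C'_card] by blast
qed

text \<open>The component of \<open>x\<close> has no outside neighbours, so the empty family of
  trees works and nothing has to be guarded.\<close>

lemma confined_initial:
  assumes "graph G" and "x \<in> verts G"
  obtains R where "R \<subseteq> verts G" and "confined G r m R x {}"
proof -
  interpret graph G by fact
  have symE: "sym (arcs_ends G)" using sym_arcs by (simp add: symmetric_def)
  let ?R = "{y. (x, y) \<in> rtrancl_on (verts G) (arcs_ends G)}"
  have sub: "?R \<subseteq> verts G" by (auto dest: in_rtrancl_on_in_F)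
  have nbr: "arcs_ends G `` ?R \<subseteq> ?R"
    by (auto intro: rtrancl_on_into_rtrancl_on adj_in_verts)
  have "confined G r m ?R x {}"
    unfolding confined_def
    by (intro conjI exI[of _ "{}"])
      (use sub nbr assms(2) connected_set_component[OF symE assms(2)] in \<open>auto simp: clique_model_def\<close>)
  with sub show thesis by (rule that)
qed

subsection \<open>From winning positions to a strategy\<close>

text \<open>Only captures in the next \<open>n\<close> rounds count; whether \<open>x\<close>
  already lies in \<open>C\<close> is not tested.\<close>

fun wins_within :: "nat \<Rightarrow> nat \<Rightarrow> ('a, 'b) pre_digraph \<Rightarrow> nat \<Rightarrow> 'a set \<Rightarrow> 'a \<Rightarrow> bool" where
  "wins_within r k G 0 C x \<longleftrightarrow> False"
| "wins_within r k G (Suc n) C x \<longleftrightarrow> (\<exists>C'. C' \<subseteq> verts G \<and> card C' \<le> k \<and>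
     (\<forall>x'. robber_move r G C C' x x' \<longrightarrow> x' \<in> C' \<or> wins_within r k G n C' x'))"

text \<open>The territory shrinks strictly in every round and always contains the robber, so its
  size bounds the number of rounds.\<close>

lemma confined_wins_within:
  assumes "graph G" and "1 \<le> r" and "3 \<le> t" and "\<not> is_minor (complete_graph t) G"
    and "confined G r (t - 2) R x C" and "finite R" and "card R \<le> n"
  shows "wins_within r ((t - 1) * (t - 2) * (4 * r)) G n C x"
  using assms(5-7)
proof (induction n arbitrary: R x C)
  case 0
  then show ?case by (auto simp: confined_def)
next
  case (Suc n)
  obtain C' where C': "C' \<subseteq> verts G" "card C' \<le> (t - 1) * (t - 2) * (4 * r)"
    "\<And>x'. robber_move r G C C' x x' \<Longrightarrow>
           x' \<in> C' \<or> (\<exists>R'. R' \<subset> R \<and> confined G r (t - 2) R' x' C')"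
    using confined_step[OF assms(1-4) Suc.prems(1)] by metis
  have "wins_within r ((t - 1) * (t - 2) * (4 * r)) G n C' x'"
    if "R' \<subset> R" "confined G r (t - 2) R' x' C'" for R' x'
  proof (rule Suc.IH[OF that(2)])
    show "finite R'" using that(1) Suc.prems(2) finite_subset by blast
    show "card R' \<le> n" using psubset_card_mono[OF Suc.prems(2) that(1)] Suc.prems(3) by simp
  qed
  then have "x' \<in> C' \<or> wins_within r ((t - 1) * (t - 2) * (4 * r)) G n C' x'"
    if "robber_move r G C C' x x'" for x'
    using C'(3)[OF that] by blast
  then show ?case using C'(1,2) by auto
qed

text \<open>Histories are listed here with the most recent position first.\<close>

primrec strategy_of :: "('a list \<Rightarrow> 'a set \<Rightarrow> 'a \<Rightarrow> 'a set) \<Rightarrow> 'a list \<Rightarrow> 'a set" where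
  "strategy_of g [] = {}"
| "strategy_of g (x # h) = g h (strategy_of g h) x"

text \<open>\<open>cops_win\<close> asks for a single function of the history, while
  \<open>wins_within\<close> gives a response in each position. Choice selects the responses, and
  the length of the history tells how many rounds remain.\<close>

lemma cops_win_if_wins_within:
  assumes "\<And>x. x \<in> verts G \<Longrightarrow> wins_within r k G N {} x"
  shows "cops_win r k G"
proof -
  define good where "good n C x C' \<longleftrightarrow> C' \<subseteq> verts G \<and> card C' \<le> k \<and>
     (\<forall>x'. robber_move r G C C' x x' \<longrightarrow> x' \<in> C' \<or> wins_within r k G n C' x')" for n C x C'
  \<comment> \<open>Here \<open>h\<close> omits the current position \<open>x\<close>, so after the
    move now being prepared \<open>N - Suc (length h)\<close> rounds remain. The default
    \<open>{}\<close> respects the bound on cops also for histories that never arise.\<close>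
  define g where "g h C x = (let n = N - Suc (length h) in
     if \<exists>C'. good n C x C' then SOME C'. good n C x C' else {})" for h :: "'a list" and C x
  define \<sigma> where "\<sigma> h = strategy_of g (rev h)" for h
  have g_good: "good n C x (g h C x)"
    if "wins_within r k G (Suc n) C x" "n = N - Suc (length h)" for n C x h
  proof -
    have "\<exists>C'. good n C x C'" using that(1) by (simp add: good_def)
    then show ?thesis using that(2) unfolding g_def Let_def by (auto intro: someI_ex)
  qed
  have g_ok: "g h C x \<subseteq> verts G \<and> card (g h C x) \<le> k" for h C x
  proof (cases "\<exists>C'. good (N - Suc (length h)) C x C'")
    case True
    then have "good (N - Suc (length h)) C x (g h C x)"
      unfolding g_def Let_def by (auto intro: someI_ex)
    then show ?thesis by (simp add: good_def)
  qed (auto simp: g_def Let_def)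
  have "strategy_of g h \<subseteq> verts G \<and> card (strategy_of g h) \<le> k" for h
    by (cases h) (use g_ok in auto)
  then have ok: "\<forall>h. \<sigma> h \<subseteq> verts G \<and> card (\<sigma> h) \<le> k" by (simp add: \<sigma>_def)
  have "\<exists>i. x i \<in> cops_at \<sigma> x i"
    if x0: "x 0 \<in> verts G" and
      mv: "\<forall>i. robber_move r G (cops_at \<sigma> x i) (cops_at \<sigma> x (Suc i)) (x i) (x (Suc i))" for x
  proof (rule ccontr)
    assume free: "\<nexists>i. x i \<in> cops_at \<sigma> x i"
    have step: "cops_at \<sigma> x (Suc i) = g (rev (map x [0..<i])) (cops_at \<sigma> x i) (x i)" for i
      by (simp add: cops_at_def \<sigma>_def)
    have "i \<le> N \<Longrightarrow> wins_within r k G (N - i) (cops_at \<sigma> x i) (x i)" for i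
    proof (induction i)
      case 0
      then show ?case using assms[OF x0] by (simp add: cops_at_def \<sigma>_def)
    next
      case (Suc i)
      then have "wins_within r k G (Suc (N - Suc i)) (cops_at \<sigma> x i) (x i)"
        by (simp add: Suc_diff_Suc)
      then have "good (N - Suc i) (cops_at \<sigma> x i) (x i) (cops_at \<sigma> x (Suc i))"
        unfolding step by (rule g_good) simp
      then show ?case using mv free unfolding good_def by blast
    qed
    \<comment> \<open>An uncaught robber would leave a position won within 0 rounds.\<close>
    from this[of N] show False by simp
  qed
  with ok show ?thesis unfolding cops_win_def by blast
qed

text \<open>For \<open>t \<le> 2\<close> the binomial coefficient is 0 while
  \<open>cop_width\<close> is at least 1, so the bound can hold only from \<open>t = 3\<close>
  on.\<close>

theorem theorem5:
  fixes G :: "('a, 'b) pre_digraph" and r t :: nat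
  assumes "graph G"
    and "1 \<le> r"
    and "3 \<le> t"
    and "\<not> is_minor (complete_graph t) G"
  shows "cop_width r G \<le> ((t - 1) choose 2) * (8 * r + 1)"
proof -
  interpret graph G by fact
  let ?k = "(t - 1) * (t - 2) * (4 * r)"
  have "wins_within r ?k G (card (verts G)) {} x" if x: "x \<in> verts G" for x
  proof -
    obtain R where R: "R \<subseteq> verts G" "confined G r (t - 2) R x {}"
      using confined_initial[OF assms(1) x] by metis
    show ?thesis
      by (rule confined_wins_within[OF assms R(2)])
        (use R(1) finite_verts card_mono finite_subset in blast)+
  qed
  then have "cops_win r ?k G" by (rule cops_win_if_wins_within)
  \<comment> \<open>The minimum defining \<open>cop_width\<close> ranges over positive numbers
    only.\<close>
  moreover have "1 \<le> ?k" using assms(2,3) by (simp add: Suc_le_eq)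
  ultimately have "cop_width r G \<le> ?k" unfolding cop_width_def by (intro Least_le) simp
  also have "(t - 1) * (t - 2) = 2 * ((t - 1) choose 2)"
  proof -
    \<comment> \<open>\<open>choose_two\<close> divides by 2 in the naturals; the division is exact
      because the two factors are consecutive.\<close>
    have "even ((t - 1) * (t - 2))" using assms(3) by (cases "even t") auto
    moreover have "t - 1 - 1 = t - 2" by simp
    ultimately show ?thesis unfolding choose_two by simp
  qed
  also have "2 * ((t - 1) choose 2) * (4 * r) \<le> ((t - 1) choose 2) * (8 * r + 1)"
    by simp
  finally show ?thesis .
qed

end
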